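(* Let $\{s(n)\}_{n\ge 0}$ be Stern's sequence, $\{t(n)\}_{n\ge0}$ the twisted Stern sequence, and $S(z)=\sum_{n\ge0}s(n)z^n$. (i) The series $$G(z):=\frac{\sum_{n\geq 0}(s(2+n)-s(1+n))z^n}{S(z)}$$ satisfies $$\sum_{n\geq 0}(s(2^{e+1}+n)-s(2^e+n))z^n=G(z^{2^e})S(z)$$ for all $e\in\mathbb{N}$. (ii) The series $$H(z):=-\frac{\sum_{n\geq 0}(t(2+n)+t(1+n))z^n}{S(z)}$$ satisfies $$(-1)^{e+1}\sum_{n\geq 0}(t(2^{e+1}+n)+t(2^e+n))z^n=H(z^{2^e})S(z)$$ for all $e\in\mathbb{N}$.
   Context: Stern's sequence is defined by $s(0)=0$, $s(1)=1$, and for $n\ge1$, $s(2n)=s(n)$, $s(2n+1)=s(n)+s(n+1)$. The twisted Stern sequence is defined by $t(0)=0$, $t(1)=1$, and for $n\ge1$, $t(2n)=-t(n)$, $t(2n+1)=-t(n)-t(n+1)$. All series are formal (Laurent) power series in $z$. *)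

theory Defs
  imports "HOL-Computational_Algebra.Formal_Laurent_Series"
begin

(* Both sequences are integer-valued, so that differences and signs are the genuine ones.
   The recursions as usually written, for the indices 2n and 2n+1 with n >= 1, are
   recovered in the lemmas stern_rec and twisted_stern_rec below. *)

function stern :: "nat \<Rightarrow> int" where
  "stern n =
     (if n = 0 then 0
      else if n = 1 then 1
      else if even n then stern (n div 2)
      else stern (n div 2) + stern (n div 2 + 1))"
  by pat_completeness auto
termination
  by (relation "Wellfounded.measure (\<lambda>n. n)") (auto elim!: oddE)

function twisted_stern :: "nat \<Rightarrow> int" where
  "twisted_stern n =
     (if n = 0 then 0
      else if n = 1 then 1
      else if even n then - twisted_stern (n div 2)
      else - twisted_stern (n div 2) - twisted_stern (n div 2 + 1))"
  by pat_completeness auto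
termination
  by (relation "Wellfounded.measure (\<lambda>n. n)") (auto elim!: oddE)

declare stern.simps [simp del] twisted_stern.simps [simp del]

lemma stern_rec:
  "stern 0 = 0"
  "stern 1 = 1"
  "n \<ge> 1 \<Longrightarrow> stern (2 * n) = stern n"
  "n \<ge> 1 \<Longrightarrow> stern (2 * n + 1) = stern n + stern (n + 1)"
  by (subst stern.simps; simp)+

lemma twisted_stern_rec:
  "twisted_stern 0 = 0"
  "twisted_stern 1 = 1"
  "n \<ge> 1 \<Longrightarrow> twisted_stern (2 * n) = - twisted_stern n"
  "n \<ge> 1 \<Longrightarrow> twisted_stern (2 * n + 1) = - twisted_stern n - twisted_stern (n + 1)"
  by (subst twisted_stern.simps; simp)+

(* The Laurent series with coefficient a n at z^n (n >= 0), over an arbitrary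
   field of characteristic 0. *)
definition gen_series :: "(nat \<Rightarrow> int) \<Rightarrow> 'a::field_char_0 fls" where
  "gen_series a = fps_to_fls (Abs_fps (\<lambda>n. of_int (a n)))"

definition S_series :: "'a::field_char_0 fls" where
  "S_series = gen_series stern"

(* S has no constant term, so the quotients are taken in the field of Laurent series;
   S_series_nonzero shows that they are genuine quotients. *)

definition G_series :: "'a::field_char_0 fls" where
  "G_series = gen_series (\<lambda>n. stern (2 + n) - stern (1 + n)) / S_series"

definition H_series :: "'a::field_char_0 fls" where
  "H_series = - (gen_series (\<lambda>n. twisted_stern (2 + n) + twisted_stern (1 + n)) / S_series)"

lemma S_series_nonzero: "S_series \<noteq> (0 :: 'a::field_char_0 fls)"
proof
  assume "S_series = (0 :: 'a fls)"
  then have "fls_nth (S_series :: 'a fls) 1 = 0"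
    by simp
  then show False
    using stern_rec(2) by (simp add: S_series_def gen_series_def)
qed

end

theory Submission
  imports Defs
begin

text \<open>
  Doubling the index turns the recursion of Stern's sequence into the functional equation
  \<open>S(z) = (z\<^sup>-\<^sup>1 + 1 + z) S(z\<^sup>2)\<close>. The series of the differences (for the
  twisted sequence, of the signed sums) at level \<open>e + 1\<close> arises from the one at level
  \<open>e\<close> by the same operation, because its constant term vanishes. Hence the quotient by
  \<open>S(z)\<close> at level \<open>e + 1\<close> is the quotient at level \<open>e\<close> with
  \<open>z\<^sup>2\<close> in place of \<open>z\<close>.
\<close>

lemma gen_series_nth:
  "fls_nth (gen_series a) k = (if k < 0 then 0 else of_int (a (nat k)))"
  by (simp add: gen_series_def)

lemma gen_series_mult_sign:
  "(- 1) ^ m * gen_series a = gen_series (\<lambda>n. (- 1) ^ m * a n)"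
  by (cases "even m") (auto intro!: fls_eqI simp: gen_series_nth)

text \<open>Only even powers occur in \<open>A(z^2)\<close>. At an even exponent only the middle
  term of \<open>z^-1 + 1 + z\<close> contributes, at an odd one only the two outer terms, which
  meet two consecutive coefficients of \<open>a\<close>.\<close>

lemma gen_series_doubling:
  assumes "a 0 = 0"
    and even: "\<And>n. b (2 * n) = a n"
    and odd: "\<And>n. b (2 * n + 1) = a n + a (n + 1)"
  shows "gen_series b =
    (fls_X_inv + 1 + fls_X) * fls_compose_power (gen_series a :: 'a::field_char_0 fls) 2"
proof (rule fls_eqI)
  fix k :: int
  have shift: "fls_nth ((fls_X_inv + 1 + fls_X) * f) k =
      fls_nth f (k + 1) + fls_nth f k + fls_nth f (k - 1)" for f :: "'a fls"
    by (simp add: distrib_right fls_X_times_conv_shift fls_X_inv_times_conv_shift)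
  consider m where "k = 2 * int m" | m where "k = 2 * int m + 1" | "k < 0"
  proof (cases "k \<ge> 0")
    case True
    then obtain n where "k = int n"
      using nonneg_int_cases by blast
    with that(1,2) show thesis
      by (cases "even n") (auto elim!: evenE oddE)
  qed (use that in linarith)
  then show "fls_nth (gen_series b :: 'a fls) k =
      fls_nth ((fls_X_inv + 1 + fls_X) * fls_compose_power (gen_series a :: 'a fls) 2) k"
  proof cases
    case (1 m)
    then have "nat k = 2 * m"
      by simp
    with 1 show ?thesis
      unfolding shift by (simp add: fls_nth_compose_power gen_series_nth even)
  next
    case (2 m)
    then have "nat k = 2 * m + 1" "(k + 1) div 2 = int (m + 1)" "nat (1 + int m) = m + 1"
      by simp_all
    with 2 show ?thesis
      unfolding shift
      by (simp add: fls_nth_compose_power gen_series_nth odd[simplified])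
  next
    case 3
    \<comment> \<open>The only negative exponent reached is -1, where the shift by
      \<open>fls_X_inv\<close> leaves the coefficient \<open>a 0\<close>.\<close>
    then have "nat ((k + 1) div 2) = 0"
      by linarith
    with 3 show ?thesis
      unfolding shift by (auto simp: fls_nth_compose_power gen_series_nth \<open>a 0 = 0\<close>)
  qed
qed

lemma fls_compose_power_1_right: "fls_compose_power f 1 = f"
  by (rule fls_eqI) (simp add: fls_nth_compose_power)

lemma fls_compose_power_compose:
  assumes "c > 0" "d > 0"
  shows "fls_compose_power (fls_compose_power f c) d = fls_compose_power f (c * d)"
proof (rule fls_eqI)
  fix k :: int
  have "int d dvd k \<and> int c dvd k div int d \<longleftrightarrow> int (c * d) dvd k"
    using assms by (auto simp: dvd_def mult_ac)
  moreover have "k div int d div int c = k div int (c * d)"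
    by (simp add: zdiv_zmult2_eq mult.commute[of "int c"])
  ultimately show "fls_nth (fls_compose_power (fls_compose_power f c) d) k =
      fls_nth (fls_compose_power f (c * d)) k"
    using assms by (auto simp: fls_nth_compose_power simp del: of_nat_mult)
qed

lemma S_series_doubling:
  "S_series = (fls_X_inv + 1 + fls_X) * fls_compose_power (S_series :: 'a::field_char_0 fls) 2"
  unfolding S_series_def
proof (rule gen_series_doubling)
  show "stern (2 * n) = stern n" for n
    using stern_rec(1,3) by (cases "n = 0") auto
  \<comment> \<open>The recursion is given for \<open>n \<ge> 1\<close>; it extends to
    \<open>n = 0\<close> because \<open>stern 0 = 0\<close>.\<close>
  show "stern (2 * n + 1) = stern n + stern (n + 1)" for n
    using stern_rec(1,2,4) by (cases "n = 0") auto
qed (rule stern_rec)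

text \<open>The family is abstract so that differences and signed sums are treated at once.\<close>

lemma gen_series_doubling_iterate:
  assumes "\<And>e. a e 0 = 0"
    and even: "\<And>e n. a (Suc e) (2 * n) = a e n"
    and odd: "\<And>e n. a (Suc e) (2 * n + 1) = a e n + a e (n + 1)"
  shows "gen_series (a e) =
    fls_compose_power (gen_series (a 0) / S_series) (2 ^ e) * (S_series :: 'a::field_char_0 fls)"
proof (induction e)
  case 0
  show ?case
    using S_series_nonzero[where 'a = 'a]
    by (simp add: fls_compose_power_1_right[simplified])
next
  case (Suc e)
  let ?Q = "gen_series (a 0) / S_series :: 'a fls"
  have "gen_series (a (Suc e)) =
      (fls_X_inv + 1 + fls_X) * fls_compose_power (gen_series (a e) :: 'a fls) 2"
    by (rule gen_series_doubling) (use assms in auto)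
  \<comment> \<open>Substituting \<open>z^2\<close> is multiplicative, so the factor
    \<open>z^-1 + 1 + z\<close> can be grouped with \<open>S(z^2)\<close>, which turns it back into
    \<open>S(z)\<close>.\<close>
  also have "\<dots> = fls_compose_power (fls_compose_power ?Q (2 ^ e)) 2 *
      ((fls_X_inv + 1 + fls_X) * fls_compose_power S_series 2)"
    by (simp only: Suc.IH fls_compose_power_mult mult_ac)
  also have "\<dots> = fls_compose_power ?Q (2 ^ Suc e) * S_series"
    by (simp only: S_series_doubling[symmetric] fls_compose_power_compose power_Suc2 zero_less_power
        zero_less_numeral)
  finally show ?case .
qed

text \<open>Constant at all powers of 2, so the constant term of every difference series
  vanishes.\<close>

lemma stern_power_2: "stern (2 ^ e) = 1"
  using stern_rec(2) by (induction e) (auto simp: stern_rec(3))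

lemma twisted_stern_power_2: "twisted_stern (2 ^ e) = (- 1) ^ e"
  using twisted_stern_rec(2) by (induction e) (auto simp: twisted_stern_rec(3))

lemma stern_shifted_rec:
  "stern (2 ^ Suc e + 2 * n) = stern (2 ^ e + n)"
  "stern (2 ^ Suc e + (2 * n + 1)) = stern (2 ^ e + n) + stern (2 ^ e + (n + 1))"
  using stern_rec(3,4)[of "2 ^ e + n"]
  by (simp_all add: algebra_simps Suc_le_eq)

text \<open>The shift keeps the index \<open>2 ^ e + n\<close> positive. Unshifted, the odd rule
  fails at \<open>n = 0\<close>, where it would give \<open>twisted_stern 1 = -1\<close>.\<close>

lemma twisted_stern_shifted_rec:
  "twisted_stern (2 ^ Suc e + 2 * n) = - twisted_stern (2 ^ e + n)"
  "twisted_stern (2 ^ Suc e + (2 * n + 1)) =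
    - twisted_stern (2 ^ e + n) - twisted_stern (2 ^ e + (n + 1))"
  using twisted_stern_rec(3,4)[of "2 ^ e + n"]
  by (simp_all add: algebra_simps Suc_le_eq)

theorem theorem1p2:
  shows "(\<forall>e::nat.
           (gen_series (\<lambda>n. stern (2 ^ (e + 1) + n) - stern (2 ^ e + n)) :: 'a::field_char_0 fls)
             = fls_compose_power G_series (2 ^ e) * S_series)
       \<and> (\<forall>e::nat.
           (- 1) ^ (e + 1) *
             (gen_series (\<lambda>n. twisted_stern (2 ^ (e + 1) + n) + twisted_stern (2 ^ e + n))
                :: 'a::field_char_0 fls)
             = fls_compose_power H_series (2 ^ e) * S_series)"
proof (intro conjI allI)
  fix e :: nat
  define d where "d e n = stern (2 ^ (e + 1) + n) - stern (2 ^ e + n)" for e n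
  have "gen_series (d e) =
      fls_compose_power (gen_series (d 0) / S_series) (2 ^ e) * (S_series :: 'a fls)"
  proof (rule gen_series_doubling_iterate)
    show "d e 0 = 0" for e
      using stern_power_2[of "Suc e"] by (simp add: d_def stern_power_2)
    show "d (Suc e) (2 * n) = d e n" for e n
      unfolding d_def Suc_eq_plus1[symmetric] stern_shifted_rec by simp
    show "d (Suc e) (2 * n + 1) = d e n + d e (n + 1)" for e n
      \<comment> \<open>The instances restrict the rewriting to the exponents, so that
        \<open>2 * n + 1\<close> and \<open>n + 1\<close> keep the form that
        \<open>stern_shifted_rec\<close> expects.\<close>
      unfolding d_def Suc_eq_plus1[of "Suc _", symmetric] Suc_eq_plus1[of e, symmetric]
        stern_shifted_rec by simp
  qed
  then show "gen_series (\<lambda>n. stern (2 ^ (e + 1) + n) - stern (2 ^ e + n)) =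
      fls_compose_power G_series (2 ^ e) * (S_series :: 'a fls)"
    by (simp add: d_def[abs_def] G_series_def)
next
  fix e :: nat
  \<comment> \<open>Each doubling changes the sign of the twisted sequence; the factor
    \<open>(- 1) ^ (e + 1)\<close> compensates, so \<open>u\<close> obeys the same recursion as the
    differences above. At level 0 it is the minus sign in \<open>H_series\<close>.\<close>
  define u where
    "u e n = (- 1) ^ (e + 1) * (twisted_stern (2 ^ (e + 1) + n) + twisted_stern (2 ^ e + n))"
    for e n
  have H: "H_series = gen_series (u 0) / (S_series :: 'a fls)"
    unfolding H_series_def minus_divide_left
    by (simp add: u_def[abs_def] gen_series_mult_sign[of 1, simplified])
  have "gen_series (u e) =
      fls_compose_power (gen_series (u 0) / S_series) (2 ^ e) * (S_series :: 'a fls)"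
  proof (rule gen_series_doubling_iterate)
    show "u e 0 = 0" for e
      using twisted_stern_power_2[of "Suc e"] by (simp add: u_def twisted_stern_power_2)
    show "u (Suc e) (2 * n) = u e n" for e n
      unfolding u_def Suc_eq_plus1[symmetric] twisted_stern_shifted_rec
      by (simp add: algebra_simps)
    show "u (Suc e) (2 * n + 1) = u e n + u e (n + 1)" for e n
      unfolding u_def Suc_eq_plus1[of "Suc _", symmetric] Suc_eq_plus1[of e, symmetric]
        twisted_stern_shifted_rec by (simp add: algebra_simps)
  qed
  then show "(- 1) ^ (e + 1) *
      gen_series (\<lambda>n. twisted_stern (2 ^ (e + 1) + n) + twisted_stern (2 ^ e + n)) =
      fls_compose_power H_series (2 ^ e) * (S_series :: 'a fls)"
    unfolding H[symmetric] by (simp add: gen_series_mult_sign u_def[abs_def] del: power_Suc)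
qed

end
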